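(* Let $G$ be a locally compact Hausdorff topological groupoid. Then the monoid $(S_G,\ast)$, with the compact-open topology inherited from $C(G,G)$, is a left topological semigroup; that is, for every $f\in S_G$ the map $S_G\to S_G$, $g\mapsto f\ast g$, is continuous.
   Context: A groupoid $G$ has a partially defined product $(x,y)\mapsto xy$ on the set $G^2\subset G\times G$ of composable pairs, and an inverse map $x\mapsto x^{-1}$. Put $r(x)=xx^{-1}$ and $d(x)=x^{-1}x$; a pair $(x,y)$ is composable if and only if $d(x)=r(y)$. The unit space is $G^0=r(G)=d(G)$, and for $u\in G^0$, $G_u=d^{-1}(u)$. A topological groupoid is a groupoid with a topology for which the inverse map and the product map $G^2\to G$ ($G^2$ with the topology induced from $G\times G$) are continuous; topologies are assumed locally compact and Hausdorff. $C(G,G)$ is the set of continuous maps from $G$ to $G$. Define $$S_G=\{f\in C(G,G): f(x)\in G_{r(x)}\text{ for all }x\in G\},$$ a monoid with operation $(f\ast g)(x)=g(f(x)x)f(x)$ and identity $r$. The compact-open topology on $C(G,G)$ is generated by the base of all sets $\bigcap_{i=1}^k M(C_i,U_i)$ with $C_i\subset G$ compact and $U_i\subset G$ open, where $M(A,B)=\{f\in C(G,G): f(A)\subset B\}$. *)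

theory Defs
  imports "HOL-Analysis.Analysis" "HOL-Algebra.Group"
begin

record 'a groupoid = "'a partial_object" +
  composable :: "('a \<times> 'a) set"
  gprod :: "'a \<Rightarrow> 'a \<Rightarrow> 'a"
  ginv :: "'a \<Rightarrow> 'a"

definition grng :: "('a, 'm) groupoid_scheme \<Rightarrow> 'a \<Rightarrow> 'a" where
  "grng G x = gprod G x (ginv G x)"

definition gdom :: "('a, 'm) groupoid_scheme \<Rightarrow> 'a \<Rightarrow> 'a" where
  "gdom G x = gprod G (ginv G x) x"

definition fibre :: "('a, 'm) groupoid_scheme \<Rightarrow> 'a \<Rightarrow> 'a set" where
  "fibre G u = {x \<in> carrier G. gdom G x = u}"

(* The usual axioms for a set with a partial product and an inverse map (Hahn, Renault).
   That composability of (x, y) amounts to gdom x = grng y follows from them: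
   see composable_iff below. *)
locale groupoid =
  fixes G :: "('a, 'm) groupoid_scheme"
  assumes composable_subset: "composable G \<subseteq> carrier G \<times> carrier G"
    and gprod_closed: "(x, y) \<in> composable G \<Longrightarrow> gprod G x y \<in> carrier G"
    and ginv_closed: "x \<in> carrier G \<Longrightarrow> ginv G x \<in> carrier G"
    and ginv_ginv: "x \<in> carrier G \<Longrightarrow> ginv G (ginv G x) = x"
    and composable_gprod_left:
      "(x, y) \<in> composable G \<Longrightarrow> (y, z) \<in> composable G \<Longrightarrow> (gprod G x y, z) \<in> composable G"
    and composable_gprod_right:
      "(x, y) \<in> composable G \<Longrightarrow> (y, z) \<in> composable G \<Longrightarrow> (x, gprod G y z) \<in> composable G"
    and gprod_assoc:
      "(x, y) \<in> composable G \<Longrightarrow> (y, z) \<in> composable G \<Longrightarrow>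
        gprod G (gprod G x y) z = gprod G x (gprod G y z)"
    and composable_ginv_left: "x \<in> carrier G \<Longrightarrow> (ginv G x, x) \<in> composable G"
    and ginv_gprod_cancel: "(x, y) \<in> composable G \<Longrightarrow> gprod G (ginv G x) (gprod G x y) = y"
    and gprod_ginv_cancel: "(z, x) \<in> composable G \<Longrightarrow> gprod G (gprod G z x) (ginv G x) = z"
begin

lemma composable_ginv_right: "x \<in> carrier G \<Longrightarrow> (x, ginv G x) \<in> composable G"
  by (metis composable_ginv_left ginv_closed ginv_ginv)

lemma composable_iff:
  "(x, y) \<in> composable G \<longleftrightarrow> x \<in> carrier G \<and> y \<in> carrier G \<and> gdom G x = grng G y"
proof (intro iffI conjI)
  assume xy: "(x, y) \<in> composable G"
  then show x: "x \<in> carrier G" and y: "y \<in> carrier G"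
    using composable_subset by auto
  have "gprod G x (gprod G y (ginv G y)) = x"
    using xy y gprod_ginv_cancel gprod_assoc composable_ginv_right by metis
  then show "gdom G x = grng G y"
    using xy y ginv_gprod_cancel composable_gprod_right composable_ginv_right
    unfolding gdom_def grng_def by metis
next
  assume *: "x \<in> carrier G \<and> y \<in> carrier G \<and> gdom G x = grng G y"
  have 1: "(x, grng G y) \<in> composable G"
    using * composable_gprod_right composable_ginv_left composable_ginv_right
    unfolding gdom_def by metis
  have 2: "(grng G y, y) \<in> composable G"
    using * composable_gprod_left composable_ginv_left composable_ginv_right
    unfolding grng_def by metis
  have "gprod G (grng G y) y = y"
    using * ginv_gprod_cancel[of "ginv G y" y] gprod_assoc
      composable_ginv_left composable_ginv_right ginv_ginv
    unfolding grng_def by metis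
  then show "(x, y) \<in> composable G"
    using composable_gprod_right[OF 1 2] by simp
qed

end

locale topological_groupoid = groupoid G
  for G :: "('a, 'm) groupoid_scheme" +
  fixes T :: "'a topology"
  assumes topspace_eq: "topspace T = carrier G"
    and continuous_ginv: "continuous_map T T (ginv G)"
    and continuous_gprod:
      "continuous_map (subtopology (prod_topology T T) (composable G)) T (\<lambda>(x, y). gprod G x y)"

(* Continuous self-maps are represented by extensional functions (undefined outside the space),
   so that equality in HOL is equality of maps on the space. *)
definition cmaps :: "'a topology \<Rightarrow> ('a \<Rightarrow> 'a) set" where
  "cmaps T = {f \<in> extensional (topspace T). continuous_map T T f}"

definition mapsets :: "'a topology \<Rightarrow> 'a set \<Rightarrow> 'a set \<Rightarrow> ('a \<Rightarrow> 'a) set" where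
  "mapsets T A B = {f \<in> cmaps T. f ` A \<subseteq> B}"

definition compact_open_base :: "'a topology \<Rightarrow> ('a \<Rightarrow> 'a) set set" where
  "compact_open_base T =
    {\<Inter>i\<in>{1..k}. mapsets T (C i) (U i) | (k::nat) C U.
      k \<ge> 1 \<and> (\<forall>i\<in>{1..k}. compactin T (C i) \<and> openin T (U i))}"

definition compact_open_topology :: "'a topology \<Rightarrow> ('a \<Rightarrow> 'a) topology" where
  "compact_open_topology T = topology_generated_by (compact_open_base T)"

lemma topspace_compact_open_topology [simp]: "topspace (compact_open_topology T) = cmaps T"
proof -
  have "\<Union>(compact_open_base T) \<subseteq> cmaps T"
    unfolding compact_open_base_def mapsets_def by fastforce
  moreover have "cmaps T \<in> compact_open_base T"
    unfolding compact_open_base_def mapsets_def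
    by (rule CollectI, rule exI[of _ 1], rule exI[of _ "\<lambda>_. {}"], rule exI[of _ "\<lambda>_. {}"]) auto
  ultimately show ?thesis
    unfolding compact_open_topology_def by auto
qed

definition S_monoid :: "('a, 'm) groupoid_scheme \<Rightarrow> 'a topology \<Rightarrow> ('a \<Rightarrow> 'a) monoid" where
  "S_monoid G T =
    \<lparr>carrier = {f \<in> cmaps T. \<forall>x\<in>carrier G. f x \<in> fibre G (grng G x)},
     monoid.mult = (\<lambda>f g. \<lambda>x\<in>carrier G. gprod G (g (gprod G (f x) x)) (f x)),
     one = (\<lambda>x\<in>carrier G. grng G x)\<rparr>"

definition left_topological_semigroup :: "('b, 'n) monoid_scheme \<Rightarrow> 'b topology \<Rightarrow> bool" where
  "left_topological_semigroup S X \<longleftrightarrow>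
    topspace X = carrier S \<and>
    (\<forall>a\<in>carrier S. \<forall>b\<in>carrier S. a \<otimes>\<^bsub>S\<^esub> b \<in> carrier S) \<and>
    (\<forall>a\<in>carrier S. \<forall>b\<in>carrier S. \<forall>c\<in>carrier S.
      (a \<otimes>\<^bsub>S\<^esub> b) \<otimes>\<^bsub>S\<^esub> c = a \<otimes>\<^bsub>S\<^esub> (b \<otimes>\<^bsub>S\<^esub> c)) \<and>
    (\<forall>a\<in>carrier S. continuous_map X X (\<lambda>b. a \<otimes>\<^bsub>S\<^esub> b))"

end

theory Submission
  imports Defs
begin

text \<open>
  Send \<open>f \<in> S\<^sub>G\<close> to the self-map \<open>\<phi>\<^sub>f x = f x \<cdot> x\<close> of \<open>G\<close>; it is written \<open>shift f\<close> below.
  The condition \<open>d (f x) = r x\<close> is exactly what makes this product defined, and the map \<open>f\<close> can be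
  recovered as \<open>f x = \<phi>\<^sub>f x \<cdot> x\<inverse>\<close>. Now \<open>(f * g) x = g (\<phi>\<^sub>f x) \<cdot> f x\<close>, hence
  \<open>\<phi>\<^bsub>f * g\<^esub> = \<phi>\<^sub>g \<circ> \<phi>\<^sub>f\<close> (\<open>shift_star\<close>): the monoid laws are those of composition of maps,
  transported by \<open>\<phi>\<close>.

  For continuity of \<open>g \<mapsto> f * g\<close>, suppose that \<open>f * g\<close> maps a compact set \<open>C\<close> into an open set
  \<open>U\<close>. Near each \<open>x \<in> C\<close>, continuity of the product gives open sets \<open>V\<close> around \<open>g (\<phi>\<^sub>f x)\<close> and
  \<open>W\<close> around \<open>f x\<close> whose composable pairs multiply into \<open>U\<close>, and local compactness gives a compact
  neighbourhood \<open>K\<close> of \<open>x\<close> with \<open>f ` K \<subseteq> W\<close> and \<open>g ` \<phi>\<^sub>f ` K \<subseteq> V\<close>. Only the last inclusion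
  involves \<open>g\<close>, and because \<open>\<phi>\<^sub>f ` K\<close> is compact it is an open condition on \<open>g\<close>; any \<open>h\<close>
  satisfying it in place of \<open>g\<close> makes \<open>f * h\<close> map \<open>K\<close> into \<open>U\<close> (\<open>star_nbhd_at_point\<close>).
  Finitely many such \<open>K\<close> cover \<open>C\<close>, and the corresponding conditions together define a
  neighbourhood of \<open>g\<close> (\<open>star_nbhd\<close>). The argument fixes \<open>f\<close>, since the compact sets
  \<open>\<phi>\<^sub>f ` K\<close> depend on it.
\<close>

section \<open>Range and domain in a groupoid\<close>

context groupoid
begin

lemma grng_closed: "x \<in> carrier G \<Longrightarrow> grng G x \<in> carrier G"
  unfolding grng_def by (intro gprod_closed composable_ginv_right)

lemma grng_ginv: "x \<in> carrier G \<Longrightarrow> grng G (ginv G x) = gdom G x"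
  by (simp add: grng_def gdom_def ginv_ginv)

lemma gdom_ginv: "x \<in> carrier G \<Longrightarrow> gdom G (ginv G x) = grng G x"
  by (simp add: grng_def gdom_def ginv_ginv)

lemma gdom_gprod:
  assumes "(x, y) \<in> composable G"
  shows "gdom G (gprod G x y) = gdom G y"
proof -
  have y: "y \<in> carrier G" using assms composable_iff by blast
  have "(gprod G x y, ginv G y) \<in> composable G"
    using assms composable_ginv_right[OF y] by (rule composable_gprod_left)
  then show ?thesis using grng_ginv[OF y] composable_iff by simp
qed

lemma grng_gprod:
  assumes "(x, y) \<in> composable G"
  shows "grng G (gprod G x y) = grng G x"
proof -
  have x: "x \<in> carrier G" using assms composable_iff by blast
  have "(ginv G x, gprod G x y) \<in> composable G"
    using composable_ginv_left[OF x] assms by (rule composable_gprod_right)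
  then show ?thesis using gdom_ginv[OF x] composable_iff by simp
qed

lemma gdom_grng: "x \<in> carrier G \<Longrightarrow> gdom G (grng G x) = grng G x"
  using gdom_gprod[OF composable_ginv_right] gdom_ginv by (simp add: grng_def)

lemma grng_gprod_self: "x \<in> carrier G \<Longrightarrow> gprod G (grng G x) x = x"
  using gprod_ginv_cancel[OF composable_ginv_right] by (simp add: grng_def ginv_ginv)

lemma gprod_gdom_self: "x \<in> carrier G \<Longrightarrow> gprod G x (gdom G x) = x"
  using ginv_gprod_cancel[OF composable_ginv_left] by (simp add: gdom_def ginv_ginv)

end

section \<open>The monoid laws\<close>

context topological_groupoid
begin

abbreviation S where "S \<equiv> carrier (S_monoid G T)"

abbreviation star (infixl "\<star>" 70) where "f \<star> g \<equiv> f \<otimes>\<^bsub>S_monoid G T\<^esub> g"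

definition shift :: "('a \<Rightarrow> 'a) \<Rightarrow> 'a \<Rightarrow> 'a" where
  "shift f x = gprod G (f x) x"

lemma S_iff:
  "f \<in> S \<longleftrightarrow> f \<in> extensional (carrier G) \<and> continuous_map T T f \<and>
    (\<forall>x\<in>carrier G. f x \<in> carrier G \<and> gdom G (f x) = grng G x)"
  by (auto simp: S_monoid_def cmaps_def fibre_def topspace_eq)

lemma S_closed: "f \<in> S \<Longrightarrow> x \<in> carrier G \<Longrightarrow> f x \<in> carrier G"
  by (simp add: S_iff)

lemma S_composable: "f \<in> S \<Longrightarrow> x \<in> carrier G \<Longrightarrow> (f x, x) \<in> composable G"
  by (simp add: S_iff composable_iff)

lemma S_continuous: "f \<in> S \<Longrightarrow> continuous_map T T f"
  by (simp add: S_iff)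

lemma S_cmaps: "f \<in> S \<Longrightarrow> f \<in> cmaps T"
  by (simp add: S_monoid_def)

lemma shift_closed: "f \<in> S \<Longrightarrow> x \<in> carrier G \<Longrightarrow> shift f x \<in> carrier G"
  unfolding shift_def by (intro gprod_closed S_composable)

lemma star_apply: "x \<in> carrier G \<Longrightarrow> (f \<star> g) x = gprod G (g (shift f x)) (f x)"
  by (simp add: S_monoid_def shift_def)

lemma star_composable:
  assumes "f \<in> S" "g \<in> S" "x \<in> carrier G"
  shows "(g (shift f x), f x) \<in> composable G"
proof -
  have "grng G (shift f x) = grng G (f x)"
    unfolding shift_def by (intro grng_gprod S_composable assms)
  then show ?thesis
    using assms shift_closed[OF assms(1,3)] by (simp add: S_iff composable_iff)
qed

text \<open>Both sides are \<open>g (shift f x) \<cdot> f x \<cdot> x\<close>, bracketed in the two possible ways.\<close>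

lemma shift_star:
  assumes "f \<in> S" "g \<in> S" "x \<in> carrier G"
  shows "shift (f \<star> g) x = shift g (shift f x)"
  using gprod_assoc[OF star_composable[OF assms] S_composable[OF assms(1,3)]] assms(3)
  by (simp add: shift_def star_apply)

lemma continuous_map_gprod:
  assumes "continuous_map X T p" "continuous_map X T q"
    and "\<And>x. x \<in> topspace X \<Longrightarrow> (p x, q x) \<in> composable G"
  shows "continuous_map X T (\<lambda>x. gprod G (p x) (q x))"
proof -
  have "continuous_map X (subtopology (prod_topology T T) (composable G)) (\<lambda>x. (p x, q x))"
    using assms by (auto simp: continuous_map_in_subtopology continuous_map_pairedI)
  from continuous_map_compose[OF this continuous_gprod] show ?thesis
    by (simp add: o_def)
qed

lemma continuous_shift: "f \<in> S \<Longrightarrow> continuous_map T T (shift f)"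
  unfolding shift_def
  by (intro continuous_map_gprod S_continuous continuous_map_id[unfolded id_def] S_composable)
    (auto simp: topspace_eq)

lemma star_closed:
  assumes f: "f \<in> S" and g: "g \<in> S"
  shows "f \<star> g \<in> S"
proof -
  have "continuous_map T T (\<lambda>x. gprod G (g (shift f x)) (f x))"
    using continuous_map_compose[OF continuous_shift[OF f] S_continuous[OF g]]
      S_continuous[OF f] star_composable[OF f g]
    by (intro continuous_map_gprod) (auto simp: o_def topspace_eq)
  then have "continuous_map T T (f \<star> g)"
    by (rule continuous_map_eq) (simp add: star_apply topspace_eq)
  moreover have "f \<star> g \<in> extensional (carrier G)"
    by (simp add: S_monoid_def)
  moreover have "(f \<star> g) x \<in> carrier G \<and> gdom G ((f \<star> g) x) = grng G x"
    if x: "x \<in> carrier G" for x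
    using gdom_gprod[OF star_composable[OF f g x]] gprod_closed[OF star_composable[OF f g x]] f x
    by (simp add: star_apply S_iff)
  ultimately show ?thesis by (simp add: S_iff)
qed

lemma S_eqI: "f \<in> S \<Longrightarrow> g \<in> S \<Longrightarrow> (\<And>x. x \<in> carrier G \<Longrightarrow> f x = g x) \<Longrightarrow> f = g"
  by (auto simp: S_iff intro: extensionalityI)

text \<open>At a point \<open>x\<close>, both bracketings are
  \<open>h (shift g (shift f x)) \<cdot> g (shift f x) \<cdot> f x\<close>, by \<open>shift_star\<close>.\<close>

lemma star_assoc:
  assumes f: "f \<in> S" and g: "g \<in> S" and h: "h \<in> S"
  shows "(f \<star> g) \<star> h = f \<star> (g \<star> h)"
proof (rule S_eqI)
  fix x assume x: "x \<in> carrier G"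
  note fx = shift_closed[OF f x]
  show "((f \<star> g) \<star> h) x = (f \<star> (g \<star> h)) x"
    using gprod_assoc[OF star_composable[OF g h fx] star_composable[OF f g x]]
    by (simp add: star_apply x fx shift_star[OF f g x])
qed (use assms in \<open>simp_all add: star_closed\<close>)

abbreviation e where "e \<equiv> \<one>\<^bsub>S_monoid G T\<^esub>"

lemma one_apply: "x \<in> carrier G \<Longrightarrow> e x = grng G x"
  by (simp add: S_monoid_def)

lemma one_closed: "e \<in> S"
proof -
  have "continuous_map T T (\<lambda>x. gprod G x (ginv G x))"
    using continuous_ginv composable_ginv_right
    by (intro continuous_map_gprod continuous_map_id[unfolded id_def]) (auto simp: topspace_eq)
  then have "continuous_map T T e"
    by (rule continuous_map_eq) (simp add: one_apply topspace_eq grng_def)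
  moreover have "e \<in> extensional (carrier G)"
    by (simp add: S_monoid_def)
  ultimately show ?thesis
    by (simp add: S_iff one_apply grng_closed gdom_grng)
qed

lemma shift_one: "x \<in> carrier G \<Longrightarrow> shift e x = x"
  by (simp add: shift_def one_apply grng_gprod_self)

lemma one_star:
  assumes "f \<in> S"
  shows "e \<star> f = f"
proof (rule S_eqI)
  fix x assume x: "x \<in> carrier G"
  have "gdom G (f x) = grng G x" using assms x by (simp add: S_iff)
  then show "(e \<star> f) x = f x"
    using gprod_gdom_self[OF S_closed[OF assms x]] x
    by (simp add: star_apply shift_one one_apply)
qed (use assms in \<open>simp_all add: star_closed one_closed\<close>)

lemma star_one:
  assumes "f \<in> S"
  shows "f \<star> e = f"
proof (rule S_eqI)
  fix x assume x: "x \<in> carrier G"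
  have "e (shift f x) = grng G (f x)"
    using grng_gprod[OF S_composable[OF assms x]] shift_closed[OF assms x]
    by (simp add: one_apply shift_def)
  then show "(f \<star> e) x = f x"
    using grng_gprod_self[OF S_closed[OF assms x]] x by (simp add: star_apply)
qed (use assms in \<open>simp_all add: star_closed one_closed\<close>)

lemma monoid_S: "monoid (S_monoid G T)"
  by (intro monoidI star_closed star_assoc one_closed one_star star_one)

end

section \<open>The compact-open topology\<close>

lemma openin_mapsets:
  assumes "compactin T C" "openin T U"
  shows "openin (compact_open_topology T) (mapsets T C U)"
proof -
  have "mapsets T C U \<in> compact_open_base T"
    unfolding compact_open_base_def using assms
    by (intro CollectI exI[of _ 1] exI[of _ "\<lambda>_. C"] exI[of _ "\<lambda>_. U"]) auto
  then show ?thesis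
    unfolding compact_open_topology_def by (rule topology_generated_by_Basis)
qed

text \<open>A map into \<open>C(G,G)\<close> need only be tested on the sets \<open>M(C,U)\<close> themselves, because preimages
  commute with the finite intersections that form the base.\<close>

lemma continuous_map_compact_open:
  assumes into: "\<And>g. g \<in> topspace X \<Longrightarrow> F g \<in> cmaps T"
    and sub: "\<And>C U. compactin T C \<Longrightarrow> openin T U \<Longrightarrow>
      openin X {g \<in> topspace X. F g \<in> mapsets T C U}"
  shows "continuous_map X (compact_open_topology T) F"
  unfolding compact_open_topology_def
proof (rule continuous_on_generated_topo)
  show "F ` topspace X \<subseteq> \<Union> (compact_open_base T)"
    using into topspace_compact_open_topology[of T]
    by (auto simp: compact_open_topology_def)
next
  fix B assume "B \<in> compact_open_base T"
  then obtain k :: nat and C U where k: "k \<ge> 1"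
    and CU: "\<And>i. i \<in> {1..k} \<Longrightarrow> compactin T (C i) \<and> openin T (U i)"
    and B: "B = (\<Inter>i\<in>{1..k}. mapsets T (C i) (U i))"
    unfolding compact_open_base_def by blast
  have "F -` B \<inter> topspace X = (\<Inter>i\<in>{1..k}. {g \<in> topspace X. F g \<in> mapsets T (C i) (U i)})"
    using k unfolding B by auto
  also have "openin X \<dots>"
    using k CU by (intro openin_INT2) (auto intro: sub)
  finally show "openin X (F -` B \<inter> topspace X)" .
qed

section \<open>Continuity of the left translations\<close>

context topological_groupoid
begin

text \<open>The local form of continuity at a point \<open>x\<close>: the neighbourhood of \<open>g\<close> is given by the single
  condition \<open>h ` shift f ` K \<subseteq> V\<close>. An \<open>h\<close> satisfying it may move values far from those of \<open>g\<close>,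
  but never out of the set \<open>V\<close>, chosen so that multiplying by points of \<open>f ` K\<close> leads into \<open>U\<close>.\<close>

lemma star_nbhd_at_point:
  assumes lc: "locally_compact_space T" and H: "Hausdorff_space T"
    and f: "f \<in> S" and g: "g \<in> S"
    and x: "x \<in> carrier G" and U: "openin T U" and gU: "(f \<star> g) x \<in> U"
  shows "\<exists>B N. openin T B \<and> x \<in> B \<and> openin (compact_open_topology T) N \<and> g \<in> N \<and>
    (\<forall>h\<in>N \<inter> S. (f \<star> h) ` B \<subseteq> U)"
proof -
  let ?D = "subtopology (prod_topology T T) (composable G)"
  let ?P = "{p \<in> topspace ?D. (\<lambda>(x, y). gprod G x y) p \<in> U}"
  have "openin ?D ?P"
    using continuous_gprod U by (rule openin_continuous_map_preimage)
  then obtain Q where Q: "openin (prod_topology T T) Q" and PQ: "?P = Q \<inter> composable G"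
    by (auto simp: openin_subtopology)
  have "(g (shift f x), f x) \<in> ?P"
    using gU star_composable[OF f g x] S_closed[OF f x] S_closed[OF g shift_closed[OF f x]]
    by (auto simp: star_apply x topspace_eq)
  then have "(g (shift f x), f x) \<in> Q" using PQ by blast
  then obtain V W where VW: "openin T V" "openin T W" "g (shift f x) \<in> V" "f x \<in> W"
      "V \<times> W \<subseteq> Q"
    using Q unfolding openin_prod_topology_alt by metis
  have prodU: "gprod G v w \<in> U" if "v \<in> V" "w \<in> W" "(v, w) \<in> composable G" for v w
  proof -
    have "(v, w) \<in> ?P" using that VW(5) PQ by blast
    then show ?thesis by simp
  qed
  let ?A = "{y \<in> topspace T. f y \<in> W} \<inter> {y \<in> topspace T. (g \<circ> shift f) y \<in> V}"
  have A: "openin T ?A"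
    using openin_continuous_map_preimage[OF S_continuous[OF f] VW(2)]
      openin_continuous_map_preimage[OF
        continuous_map_compose[OF continuous_shift[OF f] S_continuous[OF g]] VW(1)]
    by (rule openin_Int)
  have xA: "x \<in> ?A" using VW x by (simp add: topspace_eq)
  have "neighbourhood_base_of (compactin T) T"
    using lc H locally_compact_space_neighbourhood_base by blast
  from this[unfolded neighbourhood_base_of, rule_format, OF conjI[OF A xA]]
  obtain B K where BK: "openin T B" "compactin T K" "x \<in> B" "B \<subseteq> K" "K \<subseteq> ?A"
    by auto
  define N where "N = mapsets T (shift f ` K) V"
  have "openin (compact_open_topology T) N"
    unfolding N_def by (intro openin_mapsets image_compactin[OF BK(2) continuous_shift[OF f]] VW(1))
  moreover have "g \<in> N"
    using S_cmaps[OF g] BK(5) by (auto simp: N_def mapsets_def)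
  moreover have "(f \<star> h) ` B \<subseteq> U" if h: "h \<in> N \<inter> S" for h
  proof (rule image_subsetI)
    fix y assume "y \<in> B"
    then have yK: "y \<in> K" using BK(4) by blast
    then have y: "y \<in> carrier G" and fy: "f y \<in> W" using BK(5) by (auto simp: topspace_eq)
    have "h (shift f y) \<in> V" using h yK by (auto simp: N_def mapsets_def)
    then show "(f \<star> h) y \<in> U"
      using prodU[OF _ fy] star_composable[OF f _ y] h by (simp add: star_apply y)
  qed
  ultimately show ?thesis using BK(1,3) by blast
qed

lemma star_nbhd:
  assumes lc: "locally_compact_space T" and H: "Hausdorff_space T"
    and f: "f \<in> S" and g: "g \<in> S"
    and C: "compactin T C" and U: "openin T U" and sub: "(f \<star> g) ` C \<subseteq> U"
  shows "\<exists>N. openin (compact_open_topology T) N \<and> g \<in> N \<and>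
    (\<forall>h\<in>N \<inter> S. (f \<star> h) ` C \<subseteq> U)"
proof -
  have CG: "C \<subseteq> carrier G"
    using compactin_subset_topspace[OF C] by (simp add: topspace_eq)
  have "\<forall>x\<in>C. \<exists>B N. openin T B \<and> x \<in> B \<and> openin (compact_open_topology T) N \<and> g \<in> N \<and>
      (\<forall>h\<in>N \<inter> S. (f \<star> h) ` B \<subseteq> U)"
    using CG sub by (intro ballI star_nbhd_at_point[OF lc H f g _ U]) auto
  then obtain B N where
    loc: "\<forall>x\<in>C. openin T (B x) \<and> x \<in> B x \<and> openin (compact_open_topology T) (N x) \<and>
      g \<in> N x \<and> (\<forall>h\<in>N x \<inter> S. (f \<star> h) ` B x \<subseteq> U)"
    unfolding bchoice_iff by blast
  have "\<exists>\<F>. finite \<F> \<and> \<F> \<subseteq> B ` C \<and> C \<subseteq> \<Union>\<F>"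
    using loc by (intro compactinD[OF C]) auto
  then obtain \<F> where cover: "finite \<F>" "\<F> \<subseteq> B ` C" "C \<subseteq> \<Union>\<F>" by blast
  obtain F where F: "finite F" "F \<subseteq> C" "C \<subseteq> (\<Union>x\<in>F. B x)"
    using finite_subset_image[OF cover(1,2)] cover(3) by blast
  \<comment> \<open>The factor \<open>cmaps T\<close> is the whole space: it makes the intersection right when
    \<open>C\<close>, and so possibly \<open>F\<close>, is empty.\<close>
  let ?N = "(\<Inter>x\<in>F. N x) \<inter> cmaps T"
  have "openin (compact_open_topology T) ((\<Inter>x\<in>F. N x) \<inter> topspace (compact_open_topology T))"
    using F loc by (intro openin_INT) auto
  then have "openin (compact_open_topology T) ?N" by simp
  moreover have "g \<in> ?N"
    using S_cmaps[OF g] loc F by auto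
  moreover have "(f \<star> h) ` C \<subseteq> U" if "h \<in> ?N \<inter> S" for h
  proof -
    have "(f \<star> h) ` B x \<subseteq> U" if "x \<in> F" for x
      using \<open>h \<in> ?N \<inter> S\<close> that loc F(2) by blast
    then show ?thesis using F(3) by blast
  qed
  ultimately show ?thesis by blast
qed

lemma continuous_star:
  assumes "locally_compact_space T" "Hausdorff_space T" and f: "f \<in> S"
  shows "continuous_map (subtopology (compact_open_topology T) S)
    (subtopology (compact_open_topology T) S) (\<lambda>g. f \<star> g)"
proof -
  let ?X = "subtopology (compact_open_topology T) S"
  have top: "topspace ?X = S" using S_cmaps by auto
  have "continuous_map ?X (compact_open_topology T) (\<lambda>g. f \<star> g)"
  proof (rule continuous_map_compact_open)
    fix C U assume C: "compactin T C" and U: "openin T U"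
    let ?R = "{g \<in> topspace ?X. f \<star> g \<in> mapsets T C U}"
    show "openin ?X ?R"
    proof (subst openin_subopen, intro ballI)
      fix g assume "g \<in> ?R"
      then have g: "g \<in> S" and "(f \<star> g) ` C \<subseteq> U"
        by (auto simp: top mapsets_def)
      then obtain N where N: "openin (compact_open_topology T) N" "g \<in> N"
          "\<And>h. h \<in> N \<inter> S \<Longrightarrow> (f \<star> h) ` C \<subseteq> U"
        using star_nbhd[OF assms(1,2) f g C U] by blast
      have "N \<inter> S \<subseteq> ?R"
        using N(3) S_cmaps star_closed[OF f] by (auto simp: top mapsets_def)
      moreover have "openin ?X (N \<inter> S)" using N(1) by (auto simp: openin_subtopology)
      ultimately show "\<exists>T'. openin ?X T' \<and> g \<in> T' \<and> T' \<subseteq> ?R"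
        using N(2) g by blast
    qed
  qed (use top S_cmaps star_closed[OF f] in blast)
  then show ?thesis
    using star_closed[OF f] top by (auto simp: continuous_map_in_subtopology)
qed

end

theorem proposition3p5:
  fixes G :: "('a, 'm) groupoid_scheme" and T :: "'a topology"
  assumes "topological_groupoid G T"
    and "locally_compact_space T"
    and "Hausdorff_space T"
  shows "monoid (S_monoid G T) \<and>
    left_topological_semigroup (S_monoid G T)
      (subtopology (compact_open_topology T) (carrier (S_monoid G T)))"
proof -
  interpret topological_groupoid G T by (rule assms(1))
  have "topspace (subtopology (compact_open_topology T) S) = S"
    using S_cmaps by auto
  then show ?thesis
    unfolding left_topological_semigroup_def
    using monoid_S star_closed star_assoc continuous_star[OF assms(2,3)] by simp
qed

end
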